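(* Let $M$ be a partial TP matrix and let $U$ be a set of unspecified positions of $M$; write $\mathbf{u}$ for the vector of real variables placed in the positions of $U$. Then there is an assignment of real values to the positions in $U$ making the resulting partial matrix partial TP if and only if the system of strict inequalities $\{\det S(\mathbf{u})>0 \mid S \text{ is a } U\text{-atom}\}$ has a real solution.
   Context: A partial matrix is a rectangular array some of whose entries are real numbers (specified) and others unspecified; it is partial TP if every square submatrix (rows and columns arbitrary, not necessarily contiguous) consisting only of specified entries has positive determinant. For a set $U$ of unspecified positions and a square submatrix $S$ all of whose unspecified entries lie in $U$, $\det S(\mathbf{u})$ denotes its determinant as a polynomial in the variables at the positions of $U$. A $U$-atom is a square submatrix $S$ with row set $R$ and column set $C$ such that: (a) every unspecified entry of $S$ lies in $U$, and $S$ contains at least one unspecified entry; (b) for each column $c\notin C$ with $\min C<c<\max C$, there is some $r\in R$ such that position $(r,c)$ is unspecified and not in $U$; (c) for each row $r\notin R$ with $\min R<r<\max R$, there is some $c\in C$ such that position $(r,c)$ is unspecified and not in $U$. *)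

theory Defs
  imports "Jordan_Normal_Form.Determinant" "Jordan_Normal_Form.DL_Submatrix"
begin

text \<open>A partial matrix is a matrix over \<^typ>\<open>real option\<close>, with \<^term>\<open>None\<close> at the
  unspecified positions. Rows and columns are indexed from \<open>0\<close>.\<close>

type_synonym partial_mat = "real option mat"

definition unspecified :: "partial_mat \<Rightarrow> (nat \<times> nat) set" where
  "unspecified M = {(i, j). i < dim_row M \<and> j < dim_col M \<and> M $$ (i, j) = None}"

definition square_index_sets :: "partial_mat \<Rightarrow> nat set \<Rightarrow> nat set \<Rightarrow> bool" where
  "square_index_sets M R C \<longleftrightarrow>
     R \<noteq> {} \<and> R \<subseteq> {..<dim_row M} \<and> C \<subseteq> {..<dim_col M} \<and> card R = card C"

text \<open>The determinant of the submatrix with row set \<open>R\<close> and column set \<open>C\<close>; it is meaningful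
  only if that submatrix has no unspecified entries.\<close>

definition minor :: "partial_mat \<Rightarrow> nat set \<Rightarrow> nat set \<Rightarrow> real" where
  "minor M R C = det (map_mat the (submatrix M R C))"

definition partial_TP :: "partial_mat \<Rightarrow> bool" where
  "partial_TP M \<longleftrightarrow>
     (\<forall>R C. square_index_sets M R C \<and> (R \<times> C) \<inter> unspecified M = {} \<longrightarrow> minor M R C > 0)"

text \<open>The matrix obtained from \<open>M\<close> by placing the values \<open>u\<close> in the positions of \<open>U\<close>. The values
  of \<open>u\<close> outside \<open>U\<close> play no role, so \<open>u\<close> represents a vector indexed by \<open>U\<close>.\<close>

definition fill :: "partial_mat \<Rightarrow> (nat \<times> nat) set \<Rightarrow> (nat \<times> nat \<Rightarrow> real) \<Rightarrow> partial_mat" where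
  "fill M U u =
     mat (dim_row M) (dim_col M) (\<lambda>p. if p \<in> U then Some (u p) else M $$ p)"

definition atom :: "partial_mat \<Rightarrow> (nat \<times> nat) set \<Rightarrow> nat set \<Rightarrow> nat set \<Rightarrow> bool" where
  "atom M U R C \<longleftrightarrow>
     square_index_sets M R C \<and>
     (R \<times> C) \<inter> unspecified M \<subseteq> U \<and> (R \<times> C) \<inter> unspecified M \<noteq> {} \<and>
     (\<forall>c. c \<notin> C \<and> Min C < c \<and> c < Max C \<longrightarrow> (\<exists>r\<in>R. (r, c) \<in> unspecified M - U)) \<and>
     (\<forall>r. r \<notin> R \<and> Min R < r \<and> r < Max R \<longrightarrow> (\<exists>c\<in>C. (r, c) \<in> unspecified M - U))"

text \<open>The determinant of the submatrix on \<open>R\<close> and \<open>C\<close>, as a function of the variables \<open>u\<close> at the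
  positions of \<open>U\<close>; used when all unspecified entries of the submatrix lie in \<open>U\<close>.\<close>

definition det_at ::
    "partial_mat \<Rightarrow> (nat \<times> nat) set \<Rightarrow> nat set \<Rightarrow> nat set \<Rightarrow> (nat \<times> nat \<Rightarrow> real) \<Rightarrow> real" where
  "det_at M U R C u = minor (fill M U u) R C"

end

theory Submission
  imports Defs
begin

text \<open>
  Given values at \<open>U\<close> that make all atoms positive, every fully specified minor is shown to be
  positive by induction on its order and, for a fixed order, on the total spread
  \<open>(Max R - Min R) + (Max C - Min C)\<close>. A fully specified minor that is neither an atom nor free of
  positions in \<open>U\<close> can be extended by a fully specified column (or, after transposing, a row)
  \<open>c\<close> strictly between its extreme ones. A three-term Pluecker relation on \<open>S = C \<union> {c}\<close> then
  expresses the minor, multiplied by a minor of smaller order, as a sum of two products: each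
  consists of a minor of smaller order and of the minor on \<open>R\<close> and \<open>S\<close> with an extreme column
  removed, which has smaller spread.
\<close>

section \<open>A three-term Pluecker relation\<close>

text \<open>These signed maximal minors form the generalised cross product of \<open>m\<close>
  vectors of length \<open>Suc m\<close>, which is orthogonal to each of them.\<close>

lemma alternating_minors_kernel:
  fixes a :: "nat \<Rightarrow> nat \<Rightarrow> 'a :: comm_ring_1"
  assumes "i < m"
  shows "(\<Sum>j<Suc m. ((-1) ^ j * det (mat m m (\<lambda>(r, s). a r (insert_index j s)))) * a i j) = 0"
proof -
  \<comment> \<open>Expand along the top row the determinant whose row \<open>i\<close> is duplicated on top.\<close>
  define A where "A = mat (Suc m) (Suc m) (\<lambda>(r, s). a (if r = 0 then i else r - 1) s)"
  have A: "A \<in> carrier_mat (Suc m) (Suc m)"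
    by (simp add: A_def)
  have "row A 0 = row A (Suc i)"
    using assms by (auto simp: A_def)
  then have "det A = 0"
    using assms by (intro det_identical_rows[OF A, of 0 "Suc i"]) auto
  moreover have "mat_delete A 0 j = mat m m (\<lambda>(r, s). a r (insert_index j s))" if "j < Suc m" for j
    using that by (intro eq_matI) (auto simp: mat_delete_def A_def insert_index_def)
  ultimately show ?thesis
    using laplace_expansion_row[OF A, of 0]
    by (simp add: cofactor_def A_def mult_ac del: sum.lessThan_Suc)
qed

lemma kernel_trivial_if_det_nonzero:
  fixes a :: "nat \<Rightarrow> nat \<Rightarrow> 'a :: idom"
  assumes "det (mat n n (\<lambda>(i, j). a i j)) \<noteq> 0"
    and "\<And>i. i < n \<Longrightarrow> (\<Sum>j<n. a i j * v j) = 0"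
    and "j < n"
  shows "v j = 0"
proof -
  let ?A = "mat n n (\<lambda>(i, j). a i j)"
  have "?A *\<^sub>v vec n v = 0\<^sub>v n"
    using assms(2) by (intro eq_vecI) (auto simp: scalar_prod_def lessThan_atLeast0)
  moreover have "?A \<in> carrier_mat n n"
    by simp
  ultimately have "vec n v = 0\<^sub>v n"
    using assms(1) det_0_iff_vec_prod_zero vec_carrier by blast
  then show ?thesis
    using assms(3) by (metis index_vec index_zero_vec(1))
qed

text \<open>
  All three alternating vectors of maximal minors lie in the kernel of the first \<open>m\<close> rows. The two
  shorter ones, supported on the columns without the first and without the last one, therefore
  combine to the long one, with coefficients read off from the two extreme entries.
\<close>
lemma three_term_pluecker:
  fixes a :: "nat \<Rightarrow> nat \<Rightarrow> 'a :: idom"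
  assumes "k < m"
    and "det (mat m m (\<lambda>(r, s). a r (Suc s))) \<noteq> 0"
  shows "det (mat (Suc m) (Suc m) (\<lambda>(r, s). a r (insert_index (Suc k) s)))
           * det (mat m m (\<lambda>(r, s). a r (Suc s)))
       = det (mat (Suc m) (Suc m) (\<lambda>(r, s). a r (Suc s)))
           * det (mat m m (\<lambda>(r, s). a r (insert_index (Suc k) s)))
       + det (mat (Suc m) (Suc m) (\<lambda>(r, s). a r s))
           * det (mat m m (\<lambda>(r, s). a r (Suc (insert_index k s))))"
proof -
  define D where "D = det (mat m m (\<lambda>(r, s). a r (Suc s)))"
  \<comment> \<open>The columns run from 0 to \<open>Suc m\<close>. \<open>W j\<close> leaves out
    column \<open>j\<close>; \<open>Q j\<close> leaves out \<open>j\<close> and the last column;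
    \<open>P j\<close> leaves out the first column and, because of the shift, column
    \<open>Suc j\<close>.\<close>
  define W where "W j = det (mat (Suc m) (Suc m) (\<lambda>(r, s). a r (insert_index j s)))" for j
  define Q where "Q j = det (mat m m (\<lambda>(r, s). a r (insert_index j s)))" for j
  define P where "P j = det (mat m m (\<lambda>(r, s). a r (Suc (insert_index j s))))" for j
  have Q0: "Q 0 = D"
    by (simp add: Q_def D_def)
  have "mat m m (\<lambda>(r, s). a r (Suc (insert_index m s))) = mat m m (\<lambda>(r, s). a r (Suc s))"
    by (intro eq_matI) auto
  then have Pm: "P m = D"
    by (simp add: P_def D_def)
  have "mat (Suc m) (Suc m) (\<lambda>(r, s). a r (insert_index (Suc m) s))
      = mat (Suc m) (Suc m) (\<lambda>(r, s). a r s)"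
    by (intro eq_matI) auto
  then have Wm: "W (Suc m) = det (mat (Suc m) (Suc m) (\<lambda>(r, s). a r s))"
    by (simp add: W_def)
  have W0: "W 0 = det (mat (Suc m) (Suc m) (\<lambda>(r, s). a r (Suc s)))"
    by (simp add: W_def)
  \<comment> \<open>The coefficients \<open>D\<close>, \<open>- W 0\<close> and
    \<open>W (Suc m)\<close> make the combined vector vanish at column 0, as \<open>Q 0 = D\<close>,
    and at column \<open>Suc m\<close>, as \<open>P m = D\<close>. Its remaining entries are
    \<open>v j\<close> at the inner columns \<open>Suc j\<close>. The inner block has determinant
    \<open>D\<close>, so it suffices that this block annihilates \<open>v\<close>.\<close>
  define v where
    "v j = (-1) ^ Suc j * W (Suc j) * D - W 0 * ((-1) ^ Suc j * Q (Suc j))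
           + W (Suc m) * ((-1) ^ j * P j)" for j
  have "v k = 0"
  proof (rule kernel_trivial_if_det_nonzero[OF assms(2) _ assms(1)])
    fix i assume i: "i < m"
    define x where "x = (\<Sum>j<m. ((-1) ^ Suc j * W (Suc j)) * a i (Suc j))"
    define y where "y = (\<Sum>j<m. ((-1) ^ Suc j * Q (Suc j)) * a i (Suc j))"
    define z where "z = (\<Sum>j<m. ((-1) ^ j * P j) * a i (Suc j))"
    \<comment> \<open>Each kernel relation is split into its extreme terms and its inner sum, and
      solved for the latter.\<close>
    have "(\<Sum>j<Suc (Suc m). ((-1) ^ j * W j) * a i j) = 0"
      unfolding W_def by (rule alternating_minors_kernel) (use i in simp)
    then have x: "x = - (W 0 * a i 0) - (-1) ^ Suc m * W (Suc m) * a i (Suc m)"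
      unfolding sum.lessThan_Suc_shift[of _ "Suc m"] sum.lessThan_Suc[of _ m] x_def[symmetric]
      by (simp add: algebra_simps eq_neg_iff_add_eq_0)
    have "(\<Sum>j<Suc m. ((-1) ^ j * Q j) * a i j) = 0"
      unfolding Q_def by (rule alternating_minors_kernel) (use i in simp)
    then have y: "y = - (D * a i 0)"
      unfolding sum.lessThan_Suc_shift y_def[symmetric]
      by (simp add: Q0 eq_neg_iff_add_eq_0 add.commute)
    have "(\<Sum>j<Suc m. ((-1) ^ j * P j) * a i (Suc j)) = 0"
      unfolding P_def by (rule alternating_minors_kernel) (use i in simp)
    then have z: "z = - ((-1) ^ m * D * a i (Suc m))"
      unfolding sum.lessThan_Suc z_def[symmetric]
      by (simp add: Pm eq_neg_iff_add_eq_0 add.commute)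
    have "(\<Sum>j<m. a i (Suc j) * v j) = D * x - W 0 * y + W (Suc m) * z"
      by (simp add: x_def y_def z_def v_def sum_distrib_left sum.distrib sum_subtractf
          sum_negf algebra_simps)
    also have "\<dots> = 0"
      unfolding x y z by (simp add: algebra_simps)
    finally show "(\<Sum>j<m. a i (Suc j) * v j) = 0" .
  qed
  moreover have "v k = (-1) ^ k * (W 0 * Q (Suc k) + W (Suc m) * P k - W (Suc k) * D)"
    by (simp add: v_def algebra_simps)
  ultimately have "W (Suc k) * D = W 0 * Q (Suc k) + W (Suc m) * P k"
    by simp
  then show ?thesis
    by (simp only: W0 Wm) (simp only: W_def Q_def P_def D_def)
qed

section \<open>Submatrices\<close>

text \<open>The value \<open>f i\<close> has exactly \<open>i\<close> predecessors in the image,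
  which is how \<open>pick\<close> finds it.\<close>

lemma pick_image_strict_mono_on:
  assumes "strict_mono_on {..<n} f" "i < n"
  shows "pick (f ` {..<n}) i = f i"
proof -
  have "{x \<in> f ` {..<n}. x < f i} = f ` {..<i}"
    using assms by (auto simp: strict_mono_on_less)
  moreover have "inj_on f {..<i}"
    using strict_mono_on_imp_inj_on[OF assms(1)] by (rule inj_on_subset) (use assms(2) in auto)
  ultimately have "card {x \<in> f ` {..<n}. x < f i} = i"
    by (simp add: card_image)
  then show ?thesis
    using assms(2) pick_card_in_set[of "f i" "f ` {..<n}"] by simp
qed

text \<open>This passes from index sets to increasing enumerations, the form in which the Pluecker
  relation is stated.\<close>

lemma submatrix_image_strict_mono_on:
  assumes "strict_mono_on {..<m} f" "strict_mono_on {..<n} g"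
    and "f ` {..<m} \<subseteq> {..<dim_row A}" "g ` {..<n} \<subseteq> {..<dim_col A}"
  shows "submatrix A (f ` {..<m}) (g ` {..<n}) = mat m n (\<lambda>(i, j). A $$ (f i, g j))"
proof -
  have "{i. i < dim_row A \<and> i \<in> f ` {..<m}} = f ` {..<m}"
    "{j. j < dim_col A \<and> j \<in> g ` {..<n}} = g ` {..<n}"
    using assms(3,4) by auto
  moreover have "card (f ` {..<m}) = m" "card (g ` {..<n}) = n"
    using assms(1,2) by (simp_all add: card_image strict_mono_on_imp_inj_on)
  ultimately show ?thesis
    unfolding submatrix_def using assms(1,2)
    by (intro eq_matI) (simp_all add: pick_image_strict_mono_on)
qed

lemma strict_mono_on_pick: "strict_mono_on {..<card S} (pick S)"
  by (auto simp: strict_mono_on_def intro: pick_mono_le)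

lemma image_pick: "finite S \<Longrightarrow> pick S ` {..<card S} = S"
  by (intro card_subset_eq)
    (auto simp: card_image strict_mono_on_imp_inj_on strict_mono_on_pick pick_in_set_le)

lemma submatrix_carrier:
  assumes "R \<subseteq> {..<dim_row A}" "C \<subseteq> {..<dim_col A}"
  shows "submatrix A R C \<in> carrier_mat (card R) (card C)"
proof -
  have "{i. i < dim_row A \<and> i \<in> R} = R" "{j. j < dim_col A \<and> j \<in> C} = C"
    using assms by auto
  then show ?thesis
    by (auto simp: dim_submatrix)
qed

lemma submatrix_index_pick:
  assumes "R \<subseteq> {..<dim_row A}" "C \<subseteq> {..<dim_col A}" "i < card R" "j < card C"
  shows "submatrix A R C $$ (i, j) = A $$ (pick R i, pick C j)"
    and "pick R i \<in> R" "pick C j \<in> C" "pick R i < dim_row A" "pick C j < dim_col A"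
proof -
  have "{i. i < dim_row A \<and> i \<in> R} = R" "{j. j < dim_col A \<and> j \<in> C} = C"
    using assms(1,2) by auto
  then show "submatrix A R C $$ (i, j) = A $$ (pick R i, pick C j)"
    using assms by (simp add: submatrix_index)
  show "pick R i \<in> R" "pick C j \<in> C"
    using assms by (simp_all add: pick_in_set_le)
  then show "pick R i < dim_row A" "pick C j < dim_col A"
    using assms by auto
qed

lemma submatrix_map_mat:
  assumes "R \<subseteq> {..<dim_row A}" "C \<subseteq> {..<dim_col A}"
  shows "map_mat h (submatrix A R C) = submatrix (map_mat h A) R C"
  using submatrix_carrier[OF assms] submatrix_carrier[of R "map_mat h A" C] assms
  by (intro eq_matI) (auto simp: submatrix_index_pick)

lemma submatrix_cong:
  assumes "dim_row A = dim_row B" "dim_col A = dim_col B"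
    and "R \<subseteq> {..<dim_row A}" "C \<subseteq> {..<dim_col A}"
    and "\<And>i j. i \<in> R \<Longrightarrow> j \<in> C \<Longrightarrow> A $$ (i, j) = B $$ (i, j)"
  shows "submatrix A R C = submatrix B R C"
  using submatrix_carrier[of R A C] submatrix_carrier[of R B C] assms
  by (intro eq_matI) (auto simp: submatrix_index_pick)

lemma det_submatrix_transpose:
  assumes "R \<subseteq> {..<dim_row A}" "C \<subseteq> {..<dim_col A}" "card R = card C"
  shows "det (submatrix (transpose_mat A) C R) = det (submatrix A R C)"
proof -
  have "submatrix (transpose_mat A) C R = transpose_mat (submatrix A R C)"
    using submatrix_carrier[OF assms(1,2)] submatrix_carrier[of C "transpose_mat A" R] assms
    by (intro eq_matI) (auto simp: submatrix_index_pick)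
  then show ?thesis
    using det_transpose submatrix_carrier[OF assms(1,2)] assms(3) by metis
qed

lemma strict_mono_on_insert_index: "strict_mono_on S (insert_index j)"
  by (auto simp: strict_mono_on_def insert_index_def)

lemma image_insert_index:
  assumes "j \<le> m"
  shows "insert_index j ` {..<m} = {..<Suc m} - {j}"
proof
  show "insert_index j ` {..<m} \<subseteq> {..<Suc m} - {j}"
    by (auto simp: insert_index_def)
  show "{..<Suc m} - {j} \<subseteq> insert_index j ` {..<m}"
  proof
    fix x assume "x \<in> {..<Suc m} - {j}"
    then show "x \<in> insert_index j ` {..<m}"
      using assms insert_delete_index[of x j]
      by (intro image_eqI[of _ _ "delete_index j x"]) (auto simp: delete_index_def)
  qed
qed

section \<open>Removing gaps\<close>

text \<open>Multiplied by the minor on the inner columns of \<open>S\<close> and all rows of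
  \<open>R\<close> but the last, this minor is a sum of two products of positive minors by the
  Pluecker relation. That factor is itself positive and can be cancelled.\<close>

lemma det_submatrix_pos_remove_inner_column:
  fixes A :: "'a :: linordered_idom mat"
  assumes R: "R \<subseteq> {..<dim_row A}" and S: "S \<subseteq> {..<dim_col A}" and card: "card S = Suc (card R)"
    and c: "c \<in> S" "Min S < c" "c < Max S"
    and pos: "det (submatrix A R (S - {Min S})) > 0" "det (submatrix A R (S - {Max S})) > 0"
    and smaller: "\<And>R' S'. \<lbrakk>R' \<subseteq> R; S' \<subseteq> S; card R' = card S'; Suc (card R') = card R\<rbrakk>
      \<Longrightarrow> det (submatrix A R' S') > 0"
  shows "det (submatrix A R (S - {c})) > 0"
proof -
  have fin: "finite R" "finite S"
    using R S finite_subset by blast+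
  have "card R \<noteq> 0"
  proof
    assume "card R = 0"
    then obtain x where "S = {x}"
      using card by (auto simp: card_1_singleton_iff)
    then show False
      using c by auto
  qed
  then obtain m where m: "card R = Suc m"
    using not0_implies_Suc by blast
  define f where "f = pick R"
  define g where "g = pick S"
  have f: "strict_mono_on {..<Suc m} f" "f ` {..<Suc m} = R"
    using strict_mono_on_pick[of R] image_pick[OF fin(1)] by (simp_all add: f_def m)
  have g: "strict_mono_on {..<Suc (Suc m)} g" "g ` {..<Suc (Suc m)} = S"
    using strict_mono_on_pick[of S] image_pick[OF fin(2)] by (simp_all add: g_def m card)
  have g_inj: "inj_on g {..<Suc (Suc m)}"
    using g(1) by (rule strict_mono_on_imp_inj_on)
  have min: "Min S = g 0"
    using g fin by (intro Min_eqI) (auto simp: strict_mono_on_leD)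
  have max: "Max S = g (Suc m)"
    using g fin by (intro Max_eqI) (auto simp: strict_mono_on_leD)
  \<comment> \<open>Positions in \<open>S\<close> run from 0 to \<open>Suc m\<close>. An inner one
    has the form \<open>Suc k\<close> with \<open>k < m\<close>, as the Pluecker relation
    expects.\<close>
  obtain k' where "c = g k'" "k' < Suc (Suc m)"
    using c(1) g(2) by auto
  moreover from this have "k' \<noteq> 0" "k' \<noteq> Suc m"
    using c(2,3) min max by (metis less_irrefl)+
  ultimately obtain k where k: "c = g (Suc k)" "k < m"
    by (metis less_antisym not0_implies_Suc Suc_less_SucD)
  define a where "a i j = A $$ (f i, g j)" for i j
  \<comment> \<open>Every minor in the relation uses the first \<open>p\<close> rows of
    \<open>R\<close> and the columns of \<open>S\<close> at increasing positions
    \<open>h\<close>.\<close>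
  have sub: "submatrix A (f ` {..<p}) ((g \<circ> h) ` {..<p}) = mat p p (\<lambda>(r, s). a r (h s))"
    if "p \<le> Suc m" "strict_mono_on {..<p} h" "h ` {..<p} \<subseteq> {..<Suc (Suc m)}" for p h
  proof -
    have "strict_mono_on {..<p} f"
      using f(1) that(1) by (auto simp: strict_mono_on_def)
    moreover have "strict_mono_on {..<p} (g \<circ> h)"
      using g(1) that(2,3) by (auto simp: strict_mono_on_def image_subset_iff)
    moreover have "f ` {..<p} \<subseteq> R"
      using f(2) that(1) by auto
    moreover have "(g \<circ> h) ` {..<p} \<subseteq> S"
      using g(2) that(3) by auto
    ultimately show ?thesis
      using R S by (subst submatrix_image_strict_mono_on) (auto simp: a_def)
  qed
  have big: "submatrix A R (S - {g j}) = mat (Suc m) (Suc m) (\<lambda>(r, s). a r (insert_index j s))"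
    if "j < Suc (Suc m)" for j
  proof -
    have ins: "insert_index j ` {..<Suc m} = {..<Suc (Suc m)} - {j}"
      using that by (simp add: image_insert_index)
    have "g ` ({..<Suc (Suc m)} - {j}) = S - {g j}"
      using that g(2) inj_on_image_set_diff[OF g_inj, of "{..<Suc (Suc m)}" "{j}"] by simp
    then have "(g \<circ> insert_index j) ` {..<Suc m} = S - {g j}"
      by (simp only: ins image_comp[symmetric])
    moreover have "insert_index j ` {..<Suc m} \<subseteq> {..<Suc (Suc m)}"
      using ins by auto
    ultimately show ?thesis
      using sub[OF order_refl strict_mono_on_insert_index] f(2) by metis
  qed
  \<comment> \<open>The minors of order \<open>m\<close> leave out the last row of \<open>R\<close>,
    so \<open>smaller\<close> covers them.\<close>
  have small: "det (mat m m (\<lambda>(r, s). a r (h s))) > 0"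
    if "strict_mono_on {..<m} h" "h ` {..<m} \<subseteq> {..<Suc (Suc m)}" for h
  proof -
    have "inj_on (g \<circ> h) {..<m}"
      using that g_inj by (meson comp_inj_on inj_on_subset strict_mono_on_imp_inj_on)
    moreover have "inj_on f {..<m}"
      using strict_mono_on_imp_inj_on[OF f(1)] by (rule inj_on_subset) auto
    ultimately have "card ((g \<circ> h) ` {..<m}) = m" "card (f ` {..<m}) = m"
      by (simp_all only: card_image card_lessThan)
    moreover have "(g \<circ> h) ` {..<m} \<subseteq> S" "f ` {..<m} \<subseteq> R"
      using that(2) g(2) f(2) by auto
    ultimately show ?thesis
      using smaller[of "f ` {..<m}" "(g \<circ> h) ` {..<m}"] sub[of m h] that m by simp
  qed
  have D: "det (mat m m (\<lambda>(r, s). a r (Suc s))) > 0"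
    by (rule small) (auto simp: strict_mono_on_def)
  have Q: "det (mat m m (\<lambda>(r, s). a r (insert_index (Suc k) s))) > 0"
    by (rule small) (auto simp: strict_mono_on_def insert_index_def)
  have P: "det (mat m m (\<lambda>(r, s). a r (Suc (insert_index k s)))) > 0"
    by (rule small) (auto simp: strict_mono_on_def insert_index_def)
  \<comment> \<open>Skipping the last position shifts nothing, so \<open>big\<close> for
    \<open>Max S\<close> yields the unshifted matrix of the relation.\<close>
  have "mat (Suc m) (Suc m) (\<lambda>(r, s). a r (insert_index (Suc m) s))
      = mat (Suc m) (Suc m) (\<lambda>(r, s). a r s)"
    by (intro eq_matI) auto
  then have W: "det (mat (Suc m) (Suc m) (\<lambda>(r, s). a r (Suc s))) > 0"
    "det (mat (Suc m) (Suc m) (\<lambda>(r, s). a r s)) > 0"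
    using pos by (simp_all add: min max big)
  have "det (mat (Suc m) (Suc m) (\<lambda>(r, s). a r (insert_index (Suc k) s)))
          * det (mat m m (\<lambda>(r, s). a r (Suc s))) > 0"
    unfolding three_term_pluecker[OF k(2) less_imp_neq[OF D, symmetric]]
    using W P Q by (simp add: add_pos_pos)
  then show ?thesis
    using D k by (simp add: big zero_less_mult_iff)
qed

text \<open>An interior \<open>c\<close> leaves both extremes in place, and removing one of them
  then moves that end strictly inwards. Since \<open>Min C < Max C\<close>, the decrease is strict
  for truncated subtraction as well. This drives the induction among minors of equal order.\<close>

lemma spread_insert_less:
  fixes C :: "nat set"
  assumes "finite C" "C \<noteq> {}" "c \<notin> C" "Min C < c" "c < Max C"
  shows "Min (insert c C) = Min C" "Max (insert c C) = Max C"
    and "Max (insert c C - {Min C}) - Min (insert c C - {Min C}) < Max C - Min C"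
    and "Max (insert c C - {Max C}) - Min (insert c C - {Max C}) < Max C - Min C"
proof -
  show "Min (insert c C) = Min C" "Max (insert c C) = Max C"
    using assms by simp_all
  have ends: "Min C \<in> C" "Max C \<in> C"
    using assms(1,2) by simp_all
  have bounds: "Min C \<le> x \<and> x \<le> Max C" if "x \<in> insert c C" for x
    using that assms by (auto intro: less_imp_le)
  let ?L = "insert c C - {Min C}"
  have "Min ?L \<in> ?L" "Max ?L \<in> ?L"
    using assms(1,3) ends(1) by (intro Min_in Max_in; blast)+
  then have "Min ?L \<noteq> Min C" "Min C \<le> Min ?L" "Max ?L \<le> Max C"
    using bounds by blast+
  then show "Max ?L - Min ?L < Max C - Min C"
    using assms(4,5) by linarith
  let ?H = "insert c C - {Max C}"
  have "Min ?H \<in> ?H" "Max ?H \<in> ?H"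
    using assms(1,3) ends(2) by (intro Min_in Max_in; blast)+
  then have "Max ?H \<noteq> Max C" "Min C \<le> Min ?H" "Max ?H \<le> Max C"
    using bounds by blast+
  then show "Max ?H - Min ?H < Max C - Min C"
    using assms(4,5) by linarith
qed

text \<open>Here \<open>A\<close> is an ordinary matrix and \<open>B\<close> the set of positions
  that minors must avoid, which keeps the induction clear of partial matrices. A minor either has
  every gap blocked by \<open>B\<close>, and is covered by \<open>gap_free\<close>, or has a gap
  whose column or row can be inserted.\<close>

lemma pos_minors_if_gap_free_minors_pos:
  fixes A :: "'a :: linordered_idom mat" and B :: "(nat \<times> nat) set"
  assumes gap_free: "\<And>R C. \<lbrakk>R \<noteq> {}; R \<subseteq> {..<dim_row A}; C \<subseteq> {..<dim_col A}; card R = card C;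
      R \<times> C \<inter> B = {};
      \<And>c. \<lbrakk>c \<notin> C; Min C < c; c < Max C\<rbrakk> \<Longrightarrow> \<exists>r\<in>R. (r, c) \<in> B;
      \<And>r. \<lbrakk>r \<notin> R; Min R < r; r < Max R\<rbrakk> \<Longrightarrow> \<exists>c\<in>C. (r, c) \<in> B\<rbrakk>
      \<Longrightarrow> det (submatrix A R C) > 0"
    and "R \<noteq> {}" "R \<subseteq> {..<dim_row A}" "C \<subseteq> {..<dim_col A}" "card R = card C" "R \<times> C \<inter> B = {}"
  shows "det (submatrix A R C) > 0"
  using assms(2-)
proof (induction "(R, C)" arbitrary: R C
    rule: wf_induct_rule[OF wf_measures[of "[\<lambda>(R, C). card R,
      \<lambda>(R, C). (Max R - Min R) + (Max C - Min C)]"]])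
  case (1 R C)
  note IH = 1(1)
  note R = 1(2,3) and C = 1(4) and card = 1(5) and disj = 1(6)
  have fin: "finite R" "finite C"
    using R C finite_subset by blast+
  have smaller: "det (submatrix A R' C') > 0"
    if "R' \<noteq> {}" "R' \<subseteq> {..<dim_row A}" "C' \<subseteq> {..<dim_col A}" "R' \<times> C' \<inter> B = {}"
      "card R' = card C'" "Suc (card R') = card R" for R' C'
    using that by (intro IH) auto
  have narrower_columns: "det (submatrix A R C') > 0"
    if "C' \<subseteq> {..<dim_col A}" "R \<times> C' \<inter> B = {}" "card C' = card C"
      "Max C' - Min C' < Max C - Min C" for C'
    using that R card by (intro IH) simp_all
  have narrower_rows: "det (submatrix A R' C) > 0"
    if "R' \<subseteq> {..<dim_row A}" "R' \<times> C \<inter> B = {}" "card R' = card R"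
      "Max R' - Min R' < Max R - Min R" for R'
  proof (rule IH)
    show "R' \<noteq> {}"
      using that(3) R(1) fin(1) by auto
  qed (use that C card in simp_all)
  \<comment> \<open>A set with distinct extremes has at least two elements, so minors of order one
    less still have the nonempty row set that the induction hypothesis demands.\<close>
  have nonempty: "X \<noteq> {}"
    if "Suc (card X) = card Y" "Min Y < c" "c < Max Y" for X Y :: "nat set" and c
  proof
    assume "X = {}"
    then have "card Y = 1"
      using that(1) by simp
    then obtain y where "Y = {y}"
      by (rule card_1_singletonE)
    then show False
      using that(2,3) by simp
  qed
  show ?case
  proof (cases "\<exists>c. c \<notin> C \<and> Min C < c \<and> c < Max C \<and> (\<forall>r\<in>R. (r, c) \<notin> B)")
    case True
    then obtain c where c: "c \<notin> C" "Min C < c" "c < Max C" "\<forall>r\<in>R. (r, c) \<notin> B"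
      by blast
    let ?S = "insert c C"
    have "C \<noteq> {}"
      using R card fin by auto
    note spread = spread_insert_less[OF fin(2) this c(1-3)]
    from \<open>C \<noteq> {}\<close> have in_C: "Min C \<in> C" "Max C \<in> C"
      using fin by auto
    have S: "?S \<subseteq> {..<dim_col A}"
      using C c(3) in_C by auto
    \<comment> \<open>All minors in the Pluecker relation have their rows in \<open>R\<close> and
      their columns in \<open>?S\<close>, so all of them avoid \<open>B\<close>.\<close>
    have disj': "R \<times> ?S \<inter> B = {}"
      using disj c(4) by auto
    have drop: "det (submatrix A R (?S - {x})) > 0"
      if "x \<in> C" "Max (?S - {x}) - Min (?S - {x}) < Max C - Min C" for x
    proof (rule narrower_columns[OF _ _ _ that(2)])
      show "?S - {x} \<subseteq> {..<dim_col A}" "R \<times> (?S - {x}) \<inter> B = {}"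
        using S disj' by blast+
      show "card (?S - {x}) = card C"
        using that(1) c(1) fin by simp
    qed
    have "det (submatrix A R (?S - {c})) > 0"
    proof (rule det_submatrix_pos_remove_inner_column[OF R(2) S])
      show "card ?S = Suc (card R)" "c \<in> ?S" "Min ?S < c" "c < Max ?S"
        using c fin card by (simp_all add: spread)
      show "det (submatrix A R (?S - {Min ?S})) > 0"
        unfolding spread(1) using in_C(1) spread(3) by (rule drop)
      show "det (submatrix A R (?S - {Max ?S})) > 0"
        unfolding spread(2) using in_C(2) spread(4) by (rule drop)
      fix R' S' assume *: "R' \<subseteq> R" "S' \<subseteq> ?S" "card R' = card S'" "Suc (card R') = card R"
      have "R' \<noteq> {}"
        using nonempty[OF _ c(2,3)] *(4) card by simp
      moreover have "R' \<subseteq> {..<dim_row A}" "S' \<subseteq> {..<dim_col A}" "R' \<times> S' \<inter> B = {}"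
        using *(1,2) R(2) S disj' by blast+
      ultimately show "det (submatrix A R' S') > 0"
        using *(3,4) by (intro smaller)
    qed
    then show ?thesis
      using c(1) by simp
  next
    case no_column: False
    show ?thesis
    proof (cases "\<exists>r. r \<notin> R \<and> Min R < r \<and> r < Max R \<and> (\<forall>c\<in>C. (r, c) \<notin> B)")
      case True
      then obtain r where r: "r \<notin> R" "Min R < r" "r < Max R" "\<forall>c\<in>C. (r, c) \<notin> B"
        by blast
      let ?S = "insert r R"
      \<comment> \<open>A row gap of \<open>A\<close> is a column gap of \<open>?T\<close>. The
        induction hypothesis still concerns \<open>A\<close>, so the minors are carried over by
        \<open>det_submatrix_transpose\<close>.\<close>
      let ?T = "transpose_mat A"
      note spread = spread_insert_less[OF fin(1) R(1) r(1-3)]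
      have in_R: "Min R \<in> R" "Max R \<in> R"
        using fin R by auto
      have S: "?S \<subseteq> {..<dim_row A}"
        using R r(3) in_R by auto
      have disj': "?S \<times> C \<inter> B = {}"
        using disj r(4) by auto
      have drop: "det (submatrix ?T C (?S - {x})) > 0"
        if "x \<in> R" "Max (?S - {x}) - Min (?S - {x}) < Max R - Min R" for x
      proof -
        have sub: "?S - {x} \<subseteq> {..<dim_row A}" "(?S - {x}) \<times> C \<inter> B = {}"
          using S disj' by blast+
        have "card (?S - {x}) = card R"
          using that(1) r(1) fin by simp
        then show ?thesis
          using narrower_rows[OF sub _ that(2)] det_submatrix_transpose[OF sub(1) C] card by simp
      qed
      have "det (submatrix ?T C (?S - {r})) > 0"
      proof (rule det_submatrix_pos_remove_inner_column)
        show "C \<subseteq> {..<dim_row ?T}" "?S \<subseteq> {..<dim_col ?T}"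
          using C S by simp_all
        show "card ?S = Suc (card C)" "r \<in> ?S" "Min ?S < r" "r < Max ?S"
          using r fin card by (simp_all add: spread)
        show "det (submatrix ?T C (?S - {Min ?S})) > 0"
          unfolding spread(1) using in_R(1) spread(3) by (rule drop)
        show "det (submatrix ?T C (?S - {Max ?S})) > 0"
          unfolding spread(2) using in_R(2) spread(4) by (rule drop)
        fix C' S' assume *: "C' \<subseteq> C" "S' \<subseteq> ?S" "card C' = card S'" "Suc (card C') = card C"
        have S'_card: "Suc (card S') = card R"
          using *(3,4) card by simp
        have sub: "S' \<subseteq> {..<dim_row A}" "C' \<subseteq> {..<dim_col A}" "S' \<times> C' \<inter> B = {}"
          using *(1,2) C S disj' by blast+
        then have "det (submatrix A S' C') > 0"
          using nonempty[OF S'_card r(2,3)] *(3)[symmetric] S'_card by (intro smaller)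
        then show "det (submatrix ?T C' S') > 0"
          by (simp only: det_submatrix_transpose[OF sub(1,2) *(3)[symmetric]])
      qed
      then show ?thesis
        using r(1) R C card by (simp add: det_submatrix_transpose)
    next
      case False
      with no_column show ?thesis
        using R C card disj by (intro gap_free) blast+
    qed
  qed
qed

section \<open>Filled partial matrices\<close>

lemma dim_fill [simp]: "dim_row (fill M U u) = dim_row M" "dim_col (fill M U u) = dim_col M"
  by (simp_all add: fill_def)

lemma unspecified_fill: "unspecified (fill M U u) = unspecified M - U"
  by (auto simp: unspecified_def fill_def split: if_splits)

lemma minor_fill:
  assumes "square_index_sets M R C" "R \<times> C \<inter> U = {}"
  shows "minor (fill M U u) R C = minor M R C"
proof -
  have RC: "R \<subseteq> {..<dim_row M}" "C \<subseteq> {..<dim_col M}"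
    using assms(1) by (simp_all add: square_index_sets_def)
  moreover have "fill M U u $$ (i, j) = M $$ (i, j)" if "i \<in> R" "j \<in> C" for i j
  proof -
    have "(i, j) \<notin> U" "i < dim_row M" "j < dim_col M"
      using that assms(2) RC by auto
    then show ?thesis
      by (simp add: fill_def)
  qed
  ultimately have "submatrix (fill M U u) R C = submatrix M R C"
    by (intro submatrix_cong) simp_all
  then show ?thesis
    by (simp add: minor_def)
qed

theorem theorem8:
  fixes M :: partial_mat and U :: "(nat \<times> nat) set"
  assumes "partial_TP M"
    and "U \<subseteq> unspecified M"
  shows "(\<exists>u :: nat \<times> nat \<Rightarrow> real. partial_TP (fill M U u)) \<longleftrightarrow>
         (\<exists>u :: nat \<times> nat \<Rightarrow> real. \<forall>R C. atom M U R C \<longrightarrow> det_at M U R C u > 0)"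
proof (rule iff_exI, rule iffI)
  \<comment> \<open>The two conditions are shown equivalent for each \<open>u\<close> separately, so
    the same values serve on both sides.\<close>
  fix u :: "nat \<times> nat \<Rightarrow> real"
  assume TP: "partial_TP (fill M U u)"
  show "\<forall>R C. atom M U R C \<longrightarrow> det_at M U R C u > 0"
  proof (intro allI impI)
    fix R C
    assume "atom M U R C"
    then have "square_index_sets (fill M U u) R C" "R \<times> C \<inter> unspecified M \<subseteq> U"
      by (simp_all add: atom_def square_index_sets_def)
    moreover from this(2) have "R \<times> C \<inter> unspecified (fill M U u) = {}"
      by (auto simp: unspecified_fill)
    ultimately show "det_at M U R C u > 0"
      using TP by (simp add: partial_TP_def det_at_def)
  qed
next
  fix u :: "nat \<times> nat \<Rightarrow> real"
  assume atoms: "\<forall>R C. atom M U R C \<longrightarrow> det_at M U R C u > 0"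
  \<comment> \<open>Positions that remain unspecified receive the arbitrary value
    \<open>the None\<close>. They make up \<open>B\<close> below, so no minor whose positivity is
    claimed contains one.\<close>
  let ?A = "map_mat the (fill M U u)"
  have minor: "minor (fill M U u) R C = det (submatrix ?A R C)" if "square_index_sets M R C" for R C
    using that by (simp add: minor_def square_index_sets_def submatrix_map_mat)
  show "partial_TP (fill M U u)"
    unfolding partial_TP_def
  proof (intro allI impI, elim conjE)
    fix R C
    assume sq: "square_index_sets (fill M U u) R C" and disj: "R \<times> C \<inter> unspecified (fill M U u) = {}"
    have "det (submatrix ?A R C) > 0"
    proof (rule pos_minors_if_gap_free_minors_pos[where B = "unspecified M - U"])
      show "R \<noteq> {}" "R \<subseteq> {..<dim_row ?A}" "C \<subseteq> {..<dim_col ?A}" "card R = card C"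
        using sq by (simp_all add: square_index_sets_def)
      show "R \<times> C \<inter> (unspecified M - U) = {}"
        using disj by (simp only: unspecified_fill)
    next
      fix R C
      assume "R \<noteq> {}" "R \<subseteq> {..<dim_row ?A}" "C \<subseteq> {..<dim_col ?A}" "card R = card C"
      then have sq: "square_index_sets M R C"
        by (simp add: square_index_sets_def)
      assume disj: "R \<times> C \<inter> (unspecified M - U) = {}"
        and gaps: "\<And>c. \<lbrakk>c \<notin> C; Min C < c; c < Max C\<rbrakk> \<Longrightarrow> \<exists>r\<in>R. (r, c) \<in> unspecified M - U"
          "\<And>r. \<lbrakk>r \<notin> R; Min R < r; r < Max R\<rbrakk> \<Longrightarrow> \<exists>c\<in>C. (r, c) \<in> unspecified M - U"
      have "minor (fill M U u) R C > 0"
      \<comment> \<open>An atom must contain an unspecified entry. A gap-free minor without one is a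
        minor of \<open>M\<close> untouched by \<open>U\<close>, and its positivity comes from
        \<open>partial_TP M\<close>.\<close>
      proof (cases "R \<times> C \<inter> unspecified M = {}")
        case True
        then have "minor M R C > 0" "R \<times> C \<inter> U = {}"
          using assms sq by (auto simp: partial_TP_def)
        then show ?thesis
          using sq by (simp add: minor_fill)
      next
        case False
        moreover have "R \<times> C \<inter> unspecified M \<subseteq> U"
          using disj by blast
        ultimately have "atom M U R C"
          using sq gaps by (simp add: atom_def)
        then show ?thesis
          using atoms by (simp add: det_at_def)
      qed
      then show "det (submatrix ?A R C) > 0"
        by (simp only: minor[OF sq])
    qed
    then show "minor (fill M U u) R C > 0"
      using minor sq by (simp add: square_index_sets_def)
  qed
qed

end
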